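(* Consider regular partitions of $\Omega$ for which inverse inequalities hold on the finite element spaces, and assume that the time step satisfies $dt>\bar C h^2$ for a suitable constant $\bar C>0$. Then there exist positive parameters $C_1,C_2,C_3$, depending upon $h$, such that for all $\mathbf U_h=(\mathbf u_h,p_h)\in V_h$ $$\bar B_{ASGS}(\mathbf U_h,\mathbf U_h;dt)\ \ge\ C_1\|\mathbf u_h\|^2+C_2\|\nabla\mathbf u_h\|^2+C_3\|\nabla p_h\|^2,$$ where $$\bar B_{ASGS}(\mathbf U_h,\mathbf V_h;dt)=B(\mathbf U_h,\mathbf V_h)-\sum_{k=1}^{n_{el}}\Big((I-\tau_k^{-1}\tau_k')\big(\tfrac M{dt}\mathbf U_h+\mathcal L\mathbf U_h\big),\mathbf V_h\Big)_{\Omega_k}+\Big(\tfrac M{dt}\mathbf U_h,\mathbf V_h\Big)+\sum_{k=1}^{n_{el}}\Big(\tau_k'\big(\tfrac M{dt}\mathbf U_h+\mathcal L\mathbf U_h\big),-\mathcal L^*\mathbf V_h\Big)_{\Omega_k}.$$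
   Context: $\Omega\subset\mathbb R^2$ is a bounded open domain with piecewise smooth boundary, $\mu>0$ is a constant, $dt>0$ is the time step (backward Euler). $(\cdot,\cdot)$, $\|\cdot\|$ are the $L^2(\Omega)$ inner product and norm, $(\cdot,\cdot)_{\Omega_k}$ and $\|\cdot\|_k$ those of $L^2(\Omega_k)$. $V_{\mathbf u}=\{\mathbf v\in(H^1(\Omega))^2:\mathbf v=\mathbf 0\text{ on }\partial\Omega\}$, $Q=\{q\in L^2(\Omega):\int_\Omega q=0\}$. $\Omega$ is partitioned into elements $\Omega_k$, $k=1,\dots,n_{el}$, with diameters $h_k$, $h=\max_kh_k$. $V^h_{\mathbf u}$ is the space of $\mathbf v\in V_{\mathbf u}$ whose restriction to each $\Omega_k$ is (componentwise) polynomial of degree $l$; $Q^h$ is the space of $q\in Q$, continuous across inter-element boundaries, whose restriction to each $\Omega_k$ is polynomial of degree $l-1$; $V_h=V^h_{\mathbf u}\times Q^h$. The inverse inequality used is of the form $\|\Delta\mathbf v_h\|_k\le C_Ih^{-1}\|\nabla\mathbf v_h\|_k$ for $\mathbf v_h\in V^h_{\mathbf u}$ and every $k$, with $C_I$ independent of $h$. For $\mathbf U=(\mathbf u,p)$, $\mathbf V=(\mathbf v,q)$: $B(\mathbf U,\mathbf V)=\int_\Omega\mu\nabla\mathbf u:\nabla\mathbf v-\int_\Omega(\nabla\cdot\mathbf v)p+\int_\Omega(\nabla\cdot\mathbf u)q$; $M=\mathrm{diag}(1,1,0)$; $I$ is the $3\times3$ identity; $\mathcal L\mathbf U=(-\mu\Delta\mathbf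 u+\nabla p,\ \nabla\cdot\mathbf u)^T$ and $\mathcal L^*\mathbf U=(-\mu\Delta\mathbf u-\nabla p,\ -\nabla\cdot\mathbf u)^T$, evaluated elementwise. Stabilization parameters: $\tau_k=\mathrm{diag}(\tau_{1k},\tau_{1k},\tau_{2k})$ with $\tau_{1k}=h^2/(c_1\mu)$ and $\tau_{2k}=c_2/\tau_{1k}$, where $c_1,c_2$ are positive constants of the method; $\tau_k'=(\frac1{dt}M+\tau_k^{-1})^{-1}=\mathrm{diag}\big(\frac{\tau_{1k}dt}{dt+\tau_{1k}},\frac{\tau_{1k}dt}{dt+\tau_{1k}},\tau_{2k}\big)$.
   Formalization: The formal theorem adds the assumption c_1 > C_I^2 linking the method's constant to the inverse-inequality constant; for small c_1 and degree l≥2 the claim fails as dt grows. The parameters C_1, C_2, C_3 may depend on dt as well as on h. *)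

theory Defs
  imports "HOL-Analysis.Analysis"
begin

section \<open>Domains with piecewise smooth boundary\<close>

definition smooth_arc :: "(real \<Rightarrow> real^2) \<Rightarrow> bool" where
  "smooth_arc \<gamma> \<longleftrightarrow>
     arc \<gamma> \<and>
     (\<forall>t\<in>{0..1}. \<gamma> differentiable (at t within {0..1})) \<and>
     continuous_on {0..1} (\<lambda>t. vector_derivative \<gamma> (at t within {0..1})) \<and>
     (\<forall>t\<in>{0..1}. vector_derivative \<gamma> (at t within {0..1}) \<noteq> 0)"

definition piecewise_smooth_closed_curve :: "(real^2) set \<Rightarrow> bool" where
  "piecewise_smooth_closed_curve C \<longleftrightarrow>
     (\<exists>\<gamma>. simple_path \<gamma> \<and> pathfinish \<gamma> = pathstart \<gamma> \<and> path_image \<gamma> = C) \<and>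
     (\<exists>A. finite A \<and> (\<forall>\<alpha>\<in>A. smooth_arc \<alpha>) \<and> C = (\<Union>\<alpha>\<in>A. path_image \<alpha>))"

definition piecewise_smooth_domain :: "(real^2) set \<Rightarrow> bool" where
  "piecewise_smooth_domain \<Omega> \<longleftrightarrow>
     \<Omega> \<noteq> {} \<and> open \<Omega> \<and> connected \<Omega> \<and> bounded \<Omega> \<and>
     (\<exists>\<C>. finite \<C> \<and> (\<forall>C\<in>\<C>. piecewise_smooth_closed_curve C) \<and> frontier \<Omega> = \<Union>\<C>)"


section \<open>Lebesgue and Sobolev spaces\<close>

text \<open>Elements of the function spaces are represented by functions on the whole plane, of which
  only the values (almost everywhere) on the set under consideration matter.\<close>

definition L2 :: "(real^2) set \<Rightarrow> (real^2 \<Rightarrow> 'b::euclidean_space) set" where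
  "L2 S = {f. f \<in> borel_measurable (lebesgue_on S) \<and>
              integrable (lebesgue_on S) (\<lambda>x. (norm (f x))\<^sup>2)}"

definition L2_inner ::
  "(real^2) set \<Rightarrow> (real^2 \<Rightarrow> 'b::euclidean_space) \<Rightarrow> (real^2 \<Rightarrow> 'b) \<Rightarrow> real" where
  "L2_inner S f g = (LINT x|lebesgue_on S. f x \<bullet> g x)"

definition L2_norm :: "(real^2) set \<Rightarrow> (real^2 \<Rightarrow> 'b::euclidean_space) \<Rightarrow> real" where
  "L2_norm S f = sqrt (L2_inner S f f)"

definition pderiv_at :: "2 \<Rightarrow> (real^2 \<Rightarrow> real) \<Rightarrow> real^2 \<Rightarrow> real" where
  "pderiv_at i f x = frechet_derivative f (at x) (axis i 1)"

definition grad :: "(real^2 \<Rightarrow> real) \<Rightarrow> real^2 \<Rightarrow> real^2" where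
  "grad f x = (\<chi> i. pderiv_at i f x)"

primrec C_k :: "nat \<Rightarrow> (real^2 \<Rightarrow> real) \<Rightarrow> bool" where
  "C_k 0 f \<longleftrightarrow> continuous_on UNIV f"
| "C_k (Suc k) f \<longleftrightarrow> (\<forall>x. f differentiable (at x)) \<and> (\<forall>i. C_k k (pderiv_at i f))"

definition smooth :: "(real^2 \<Rightarrow> real) \<Rightarrow> bool" where
  "smooth f \<longleftrightarrow> (\<forall>k. C_k k f)"

definition test_function :: "(real^2) set \<Rightarrow> (real^2 \<Rightarrow> real) \<Rightarrow> bool" where
  "test_function \<Omega> \<phi> \<longleftrightarrow>
     smooth \<phi> \<and> compact (closure {x. \<phi> x \<noteq> 0}) \<and> closure {x. \<phi> x \<noteq> 0} \<subseteq> \<Omega>"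

definition is_weak_grad ::
  "(real^2) set \<Rightarrow> (real^2 \<Rightarrow> real) \<Rightarrow> (real^2 \<Rightarrow> real^2) \<Rightarrow> bool" where
  "is_weak_grad \<Omega> v g \<longleftrightarrow>
     (\<forall>\<phi> i. test_function \<Omega> \<phi> \<longrightarrow>
        (LINT x|lebesgue_on \<Omega>. v x * pderiv_at i \<phi> x) = - (LINT x|lebesgue_on \<Omega>. g x $ i * \<phi> x))"

definition H1 :: "(real^2) set \<Rightarrow> (real^2 \<Rightarrow> real) set" where
  "H1 \<Omega> = {v \<in> L2 \<Omega>. \<exists>g \<in> L2 \<Omega>. is_weak_grad \<Omega> v g}"

text \<open>The choice is immaterial: weak gradients are unique up to null sets.\<close>

definition weak_grad :: "(real^2) set \<Rightarrow> (real^2 \<Rightarrow> real) \<Rightarrow> real^2 \<Rightarrow> real^2" where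
  "weak_grad \<Omega> v = (SOME g. g \<in> L2 \<Omega> \<and> is_weak_grad \<Omega> v g)"

text \<open>The trace is the continuous extension of the restriction to the boundary:
  \<open>v\<close> has trace \<open>g\<close> if functions smooth up to the boundary converge to \<open>v\<close> in \<open>H\<^sup>1\<close> and their
  boundary values converge to \<open>g\<close> in \<open>L\<^sup>2\<close> with respect to arc length, here expressed along the
  smooth arcs that make up the boundary.\<close>

definition has_trace :: "(real^2) set \<Rightarrow> (real^2 \<Rightarrow> real) \<Rightarrow> (real^2 \<Rightarrow> real) \<Rightarrow> bool" where
  "has_trace \<Omega> v g \<longleftrightarrow>
     (\<exists>\<phi>. (\<forall>n. smooth (\<phi> n)) \<and>
        (\<lambda>n. L2_norm \<Omega> (\<lambda>x. \<phi> n x - v x)) \<longlonglongrightarrow> 0 \<and>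
        (\<lambda>n. L2_norm \<Omega> (\<lambda>x. grad (\<phi> n) x - weak_grad \<Omega> v x)) \<longlonglongrightarrow> 0 \<and>
        (\<forall>\<gamma>. smooth_arc \<gamma> \<and> path_image \<gamma> \<subseteq> frontier \<Omega> \<longrightarrow>
           (\<lambda>n::nat. integral {0..1} (\<lambda>t. (\<phi> n (\<gamma> t) - g (\<gamma> t))\<^sup>2 *
              norm (vector_derivative \<gamma> (at t within {0..1})))) \<longlonglongrightarrow> 0))"

definition velocity_space :: "(real^2) set \<Rightarrow> (real^2 \<Rightarrow> real^2) set" where
  "velocity_space \<Omega> =
     {v. \<forall>i. (\<lambda>x. v x $ i) \<in> H1 \<Omega> \<and> has_trace \<Omega> (\<lambda>x. v x $ i) (\<lambda>x. 0)}"

definition pressure_space :: "(real^2) set \<Rightarrow> (real^2 \<Rightarrow> real) set" where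
  "pressure_space \<Omega> = {q \<in> L2 \<Omega>. (LINT x|lebesgue_on \<Omega>. q x) = 0}"

definition weak_grad_vec :: "(real^2) set \<Rightarrow> (real^2 \<Rightarrow> real^2) \<Rightarrow> real^2 \<Rightarrow> real^2^2" where
  "weak_grad_vec \<Omega> u x = (\<chi> i. weak_grad \<Omega> (\<lambda>y. u y $ i) x)"

definition weak_div :: "(real^2) set \<Rightarrow> (real^2 \<Rightarrow> real^2) \<Rightarrow> real^2 \<Rightarrow> real" where
  "weak_div \<Omega> u x = (\<Sum>i\<in>UNIV. weak_grad_vec \<Omega> u x $ i $ i)"


section \<open>Partitions and finite element spaces\<close>

text \<open>Elements are open; what they leave uncovered is the (null) skeleton of the mesh.\<close>

definition mesh_of :: "(real^2) set \<Rightarrow> (real^2) set set \<Rightarrow> bool" where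
  "mesh_of \<Omega> \<T> \<longleftrightarrow>
     finite \<T> \<and> \<T> \<noteq> {} \<and>
     (\<forall>K\<in>\<T>. K \<noteq> {} \<and> open K \<and> connected K \<and> K \<subseteq> \<Omega>) \<and>
     pairwise disjnt \<T> \<and> negligible (\<Omega> - \<Union>\<T>)"

definition mesh_size :: "(real^2) set set \<Rightarrow> real" where
  "mesh_size \<T> = Max (diameter ` \<T>)"

text \<open>Shape regularity: the ratio of the diameter of an element to that of some inscribed disc is
  bounded by \<open>\<sigma>\<close>.\<close>

definition regular_mesh :: "real \<Rightarrow> (real^2) set set \<Rightarrow> bool" where
  "regular_mesh \<sigma> \<T> \<longleftrightarrow>
     (\<forall>K\<in>\<T>. \<exists>x r. r > 0 \<and> ball x r \<subseteq> K \<and> diameter K \<le> \<sigma> * (2 * r))"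

definition poly_on :: "nat \<Rightarrow> (real^2) set \<Rightarrow> (real^2 \<Rightarrow> real) \<Rightarrow> bool" where
  "poly_on d K f \<longleftrightarrow>
     (\<exists>c :: nat \<Rightarrow> nat \<Rightarrow> real. \<forall>x\<in>K. f x = (\<Sum>i\<le>d. \<Sum>j\<le>d - i. c i j * (x $ 1) ^ i * (x $ 2) ^ j))"

definition velocity_fe_space ::
  "(real^2) set \<Rightarrow> (real^2) set set \<Rightarrow> nat \<Rightarrow> (real^2 \<Rightarrow> real^2) set" where
  "velocity_fe_space \<Omega> \<T> l =
     {v \<in> velocity_space \<Omega>. \<forall>K\<in>\<T>. \<forall>i. poly_on l K (\<lambda>x. v x $ i)}"

definition pressure_fe_space ::
  "(real^2) set \<Rightarrow> (real^2) set set \<Rightarrow> nat \<Rightarrow> (real^2 \<Rightarrow> real) set" where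
  "pressure_fe_space \<Omega> \<T> l =
     {q \<in> pressure_space \<Omega>. continuous_on \<Omega> q \<and> (\<forall>K\<in>\<T>. poly_on (l - 1) K q)}"


section \<open>The stabilized bilinear form\<close>

text \<open>Operators applied element by element use classical derivatives: finite element functions are
  polynomials on the open elements. In particular \<^term>\<open>grad p\<close>, for a finite element
  pressure \<open>p\<close>, is defined off the skeleton, hence almost everywhere.\<close>

definition laplacian :: "(real^2 \<Rightarrow> real) \<Rightarrow> real^2 \<Rightarrow> real" where
  "laplacian f x = (\<Sum>i\<in>UNIV. pderiv_at i (pderiv_at i f) x)"

definition laplacian_vec :: "(real^2 \<Rightarrow> real^2) \<Rightarrow> real^2 \<Rightarrow> real^2" where
  "laplacian_vec u x = (\<chi> i. laplacian (\<lambda>y. u y $ i) x)"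

definition divergence :: "(real^2 \<Rightarrow> real^2) \<Rightarrow> real^2 \<Rightarrow> real" where
  "divergence u x = (\<Sum>i\<in>UNIV. pderiv_at i (\<lambda>y. u y $ i) x)"

definition inverse_inequality ::
  "(real^2) set \<Rightarrow> (real^2) set set \<Rightarrow> nat \<Rightarrow> real \<Rightarrow> bool" where
  "inverse_inequality \<Omega> \<T> l C\<^sub>I \<longleftrightarrow>
     (\<forall>v \<in> velocity_fe_space \<Omega> \<T> l. \<forall>K\<in>\<T>.
        L2_norm K (laplacian_vec v) \<le> C\<^sub>I / mesh_size \<T> * L2_norm K (weak_grad_vec \<Omega> v))"

type_synonym velocity = "real^2 \<Rightarrow> real^2"
type_synonym pressure = "real^2 \<Rightarrow> real"

definition stokes_form ::
  "(real^2) set \<Rightarrow> real \<Rightarrow> velocity \<times> pressure \<Rightarrow> velocity \<times> pressure \<Rightarrow> real" where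
  "stokes_form \<Omega> \<mu> = (\<lambda>(u, p) (v, q).
     (LINT x|lebesgue_on \<Omega>. \<mu> * (weak_grad_vec \<Omega> u x \<bullet> weak_grad_vec \<Omega> v x))
     - (LINT x|lebesgue_on \<Omega>. weak_div \<Omega> v x * p x)
     + (LINT x|lebesgue_on \<Omega>. weak_div \<Omega> u x * q x))"

definition join :: "real^2 \<Rightarrow> real \<Rightarrow> real^3" where
  "join a b = vector [a $ 1, a $ 2, b]"

definition diag3 :: "real \<Rightarrow> real \<Rightarrow> real \<Rightarrow> real^3^3" where
  "diag3 a b c = (\<chi> i j. if i = j then vector [a, b, c] $ i else 0)"

definition field :: "velocity \<times> pressure \<Rightarrow> real^2 \<Rightarrow> real^3" where
  "field = (\<lambda>(u, p) x. join (u x) (p x))"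

definition stokes_op :: "real \<Rightarrow> velocity \<times> pressure \<Rightarrow> real^2 \<Rightarrow> real^3" where
  "stokes_op \<mu> = (\<lambda>(u, p) x. join (- \<mu> *\<^sub>R laplacian_vec u x + grad p x) (divergence u x))"

definition stokes_op_adj :: "real \<Rightarrow> velocity \<times> pressure \<Rightarrow> real^2 \<Rightarrow> real^3" where
  "stokes_op_adj \<mu> = (\<lambda>(u, p) x. join (- \<mu> *\<^sub>R laplacian_vec u x - grad p x) (- divergence u x))"

definition mass_matrix :: "real^3^3" where
  "mass_matrix = diag3 1 1 0"

definition stab_1 :: "real \<Rightarrow> real \<Rightarrow> real \<Rightarrow> real" where
  "stab_1 \<mu> c\<^sub>1 h = h\<^sup>2 / (c\<^sub>1 * \<mu>)"

definition stab_2 :: "real \<Rightarrow> real \<Rightarrow> real \<Rightarrow> real \<Rightarrow> real" where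
  "stab_2 \<mu> c\<^sub>1 c\<^sub>2 h = c\<^sub>2 / stab_1 \<mu> c\<^sub>1 h"

definition stab_matrix :: "real \<Rightarrow> real \<Rightarrow> real \<Rightarrow> real \<Rightarrow> real^3^3" where
  "stab_matrix \<mu> c\<^sub>1 c\<^sub>2 h = diag3 (stab_1 \<mu> c\<^sub>1 h) (stab_1 \<mu> c\<^sub>1 h) (stab_2 \<mu> c\<^sub>1 c\<^sub>2 h)"

definition stab_matrix_dt :: "real \<Rightarrow> real \<Rightarrow> real \<Rightarrow> real \<Rightarrow> real \<Rightarrow> real^3^3" where
  "stab_matrix_dt \<mu> c\<^sub>1 c\<^sub>2 dt h =
     matrix_inv ((1 / dt) *\<^sub>R mass_matrix + matrix_inv (stab_matrix \<mu> c\<^sub>1 c\<^sub>2 h))"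

text \<open>The stabilization parameters involve the global mesh size only, so they are the same on all
  elements.\<close>

definition B_ASGS ::
  "(real^2) set \<Rightarrow> (real^2) set set \<Rightarrow> real \<Rightarrow> real \<Rightarrow> real \<Rightarrow> real \<Rightarrow>
   velocity \<times> pressure \<Rightarrow> velocity \<times> pressure \<Rightarrow> real" where
  "B_ASGS \<Omega> \<T> \<mu> c\<^sub>1 c\<^sub>2 dt U V =
     (let \<tau> = stab_matrix \<mu> c\<^sub>1 c\<^sub>2 (mesh_size \<T>);
          \<tau>' = stab_matrix_dt \<mu> c\<^sub>1 c\<^sub>2 dt (mesh_size \<T>);
          MU = (\<lambda>x. (1 / dt) *\<^sub>R (mass_matrix *v field U x));
          R = (\<lambda>x. MU x + stokes_op \<mu> U x)
      in stokes_form \<Omega> \<mu> U V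
         - (\<Sum>K\<in>\<T>. L2_inner K (\<lambda>x. (mat 1 - matrix_inv \<tau> ** \<tau>') *v R x) (field V))
         + L2_inner \<Omega> MU (field V)
         + (\<Sum>K\<in>\<T>. L2_inner K (\<lambda>x. \<tau>' *v R x) (\<lambda>x. - stokes_op_adj \<mu> V x)))"

end

theory Submission
  imports Defs
begin

text \<open>Testing with \<open>V\<^sub>h = U\<^sub>h\<close> cancels the skew terms. With \<open>\<tau> = \<tau>\<^sub>1\<close>, \<open>s = dt + \<tau>\<close>
  what remains is
  \<open>\<mu>\<parallel>\<nabla>u\<parallel>\<^sup>2 + \<parallel>u\<parallel>\<^sup>2/s + \<Sum>\<^sub>K ((2\<tau>\<mu>/s) (u, \<Delta>u)\<^sub>K - (\<tau> dt \<mu>\<^sup>2/s) \<parallel>\<Delta>u\<parallel>\<^sup>2\<^sub>K + (\<tau> dt/s) \<parallel>\<nabla>p\<parallel>\<^sup>2\<^sub>K + \<tau>\<^sub>2 \<parallel>\<nabla>\<cdot>u\<parallel>\<^sup>2\<^sub>K)\<close>.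
  Put \<open>r = C\<^sub>I\<^sup>2/c\<^sub>1 < 1\<close>. Young's inequality with weight \<open>r\<close> for the mixed term, together with
  \<open>\<tau>\<mu>\<parallel>\<Delta>u\<parallel>\<^sup>2\<^sub>K \<le> r\<parallel>\<nabla>u\<parallel>\<^sup>2\<^sub>K\<close> from the inverse inequality, leaves the coefficients
  \<open>(1 - r)/s\<close> for \<open>\<parallel>u\<parallel>\<^sup>2\<close> and \<open>\<mu>(1 - r)dt/s\<close> for \<open>\<parallel>\<nabla>u\<parallel>\<^sup>2\<close>.\<close>

section \<open>Piecewise polynomials\<close>

text \<open>Forgets the degree and the coefficients kept by \<open>poly_on\<close>: what remains is
  closed under products and derivatives, and suffices for every integrability claim below.\<close>

definition polynomial_on :: "'a::real_normed_vector set \<Rightarrow> ('a \<Rightarrow> real) \<Rightarrow> bool" where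
  "polynomial_on K f \<longleftrightarrow> (\<exists>P. real_polynomial_function P \<and> (\<forall>x\<in>K. f x = P x))"

lemma polynomial_on_const: "polynomial_on K (\<lambda>x. c)"
  unfolding polynomial_on_def by blast

lemma polynomial_on_add:
  assumes "polynomial_on K f" "polynomial_on K g"
  shows "polynomial_on K (\<lambda>x. f x + g x)"
proof -
  obtain P Q where "real_polynomial_function P" "\<forall>x\<in>K. f x = P x"
    "real_polynomial_function Q" "\<forall>x\<in>K. g x = Q x"
    using assms unfolding polynomial_on_def by blast
  then show ?thesis
    unfolding polynomial_on_def by (intro exI[of _ "\<lambda>x. P x + Q x"]) auto
qed

lemma polynomial_on_mult:
  assumes "polynomial_on K f" "polynomial_on K g"
  shows "polynomial_on K (\<lambda>x. f x * g x)"
proof -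
  obtain P Q where "real_polynomial_function P" "\<forall>x\<in>K. f x = P x"
    "real_polynomial_function Q" "\<forall>x\<in>K. g x = Q x"
    using assms unfolding polynomial_on_def by blast
  then show ?thesis
    unfolding polynomial_on_def by (intro exI[of _ "\<lambda>x. P x * Q x"]) auto
qed

lemma polynomial_on_sum:
  "(\<And>i. i \<in> I \<Longrightarrow> polynomial_on K (f i)) \<Longrightarrow> polynomial_on K (\<lambda>x. \<Sum>i\<in>I. f i x)"
  by (induction I rule: infinite_finite_induct)
     (simp_all add: polynomial_on_const polynomial_on_add)

lemmas polynomial_on_intros = polynomial_on_const polynomial_on_add polynomial_on_mult
  polynomial_on_sum

lemma poly_on_imp_polynomial_on:
  assumes "poly_on d K f"
  shows "polynomial_on K f"
proof -
  obtain c :: "nat \<Rightarrow> nat \<Rightarrow> real" where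
    c: "\<forall>x\<in>K. f x = (\<Sum>i\<le>d. \<Sum>j\<le>d - i. c i j * (x $ 1) ^ i * (x $ 2) ^ j)"
    using assms unfolding poly_on_def by blast
  have "real_polynomial_function (\<lambda>x::real^2. x $ i)" for i
    by (intro real_polynomial_function.intros(1) bounded_linear_vec_nth)
  then have "real_polynomial_function
      (\<lambda>x. \<Sum>i\<le>d. \<Sum>j\<le>d - i. c i j * (x $ 1) ^ i * ((x::real^2) $ 2) ^ j)"
    by (intro real_polynomial_function_sum real_polynomial_function.intros(4)
        real_polynomial_function_power real_polynomial_function.intros(2)) auto
  with c show ?thesis
    unfolding polynomial_on_def by blast
qed

text \<open>The induction carries a genuine derivative together with the polynomiality of its value
  at \<open>v\<close>, because the product rule needs the derivatives of both factors; uniqueness of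
  derivatives then gives \<open>frechet_derivative\<close>.\<close>

lemma real_polynomial_function_directional_derivative:
  assumes "real_polynomial_function P"
  obtains Q where "real_polynomial_function Q" "\<And>x. frechet_derivative P (at x) v = Q x"
proof -
  have "\<exists>P'. real_polynomial_function (\<lambda>x. P' x v) \<and> (\<forall>x. (P has_derivative P' x) (at x))"
    using assms
  proof (induction rule: real_polynomial_function.induct)
    case (linear f)
    then show ?case
      by (intro exI[of _ "\<lambda>x. f"]) (auto intro: bounded_linear_imp_has_derivative)
  next
    case (const c)
    show ?case
      by (intro exI[of _ "\<lambda>x h. 0"]) auto
  next
    case (add f g)
    then obtain f' g' where
      "real_polynomial_function (\<lambda>x. f' x v)" "\<forall>x. (f has_derivative f' x) (at x)"
      "real_polynomial_function (\<lambda>x. g' x v)" "\<forall>x. (g has_derivative g' x) (at x)"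
      by blast
    then show ?case
      by (intro exI[of _ "\<lambda>x h. f' x h + g' x h"] conjI allI has_derivative_add
          real_polynomial_function.intros(3)) auto
  next
    case (mult f g)
    then obtain f' g' where
      "real_polynomial_function (\<lambda>x. f' x v)" "\<forall>x. (f has_derivative f' x) (at x)"
      "real_polynomial_function (\<lambda>x. g' x v)" "\<forall>x. (g has_derivative g' x) (at x)"
      by blast
    with mult.hyps show ?case
      by (intro exI[of _ "\<lambda>x h. f x * g' x h + f' x h * g x"] conjI allI has_derivative_mult
          real_polynomial_function.intros(3,4)) auto
  qed
  then show ?thesis
    using that by (metis frechet_derivative_at)
qed

text \<open>Outside \<open>K\<close> the function \<open>f\<close> is arbitrary. Since
  \<open>K\<close> is open, \<open>f\<close> agrees with its polynomial near each point of
  \<open>K\<close>, and derivatives are local.\<close>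

lemma polynomial_on_pderiv_at:
  assumes "open K" "polynomial_on K f"
  shows "polynomial_on K (pderiv_at i f)"
proof -
  obtain P where P: "real_polynomial_function P" "\<forall>x\<in>K. f x = P x"
    using assms(2) unfolding polynomial_on_def by blast
  obtain Q where Q: "real_polynomial_function Q"
    "\<And>x. frechet_derivative P (at x) (axis i 1) = Q x"
    using real_polynomial_function_directional_derivative[OF P(1)] by blast
  have "pderiv_at i f x = Q x" if "x \<in> K" for x
  proof -
    have "P differentiable at x"
      using P(1) by (rule differentiable_at_real_polynomial_function)
    then have "frechet_derivative P (at x) = frechet_derivative f (at x)"
      using frechet_derivative_transform_within_open[of P x K f] assms(1) that P(2) by auto
    then show ?thesis
      using Q(2) unfolding pderiv_at_def by metis
  qed
  with Q(1) show ?thesis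
    unfolding polynomial_on_def by blast
qed

lemma polynomial_on_grad:
  "open K \<Longrightarrow> polynomial_on K p \<Longrightarrow> polynomial_on K (\<lambda>x. grad p x $ i)"
  unfolding grad_def by (simp add: polynomial_on_pderiv_at)

lemma polynomial_on_laplacian_vec:
  "open K \<Longrightarrow> (\<And>i. polynomial_on K (\<lambda>x. u x $ i)) \<Longrightarrow> polynomial_on K (\<lambda>x. laplacian_vec u x $ i)"
  unfolding laplacian_vec_def laplacian_def
  by (simp add: polynomial_on_pderiv_at polynomial_on_sum)

lemma polynomial_on_divergence:
  "open K \<Longrightarrow> (\<And>i. polynomial_on K (\<lambda>x. u x $ i)) \<Longrightarrow> polynomial_on K (divergence u)"
  unfolding divergence_def
  by (simp add: polynomial_on_pderiv_at polynomial_on_sum)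

lemma polynomial_on_inner:
  fixes f g :: "'a::real_normed_vector \<Rightarrow> real^'n"
  assumes "\<And>i. polynomial_on K (\<lambda>x. f x $ i)" "\<And>i. polynomial_on K (\<lambda>x. g x $ i)"
  shows "polynomial_on K (\<lambda>x. f x \<bullet> g x)"
  unfolding inner_vec_def using assms by (simp add: polynomial_on_intros)

section \<open>Integrability on bounded open elements\<close>

lemma integrable_lebesgue_on_subset:
  fixes f :: "'a::euclidean_space \<Rightarrow> 'b::{banach, second_countable_topology}"
  assumes "integrable (lebesgue_on S) f" "S \<in> sets lebesgue" "T \<in> sets lebesgue" "T \<subseteq> S"
  shows "integrable (lebesgue_on T) f"
proof -
  have "set_integrable lebesgue S f"
    using assms(1,2) unfolding set_integrable_def by (subst (asm) integrable_restrict_space) auto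
  then have "set_integrable lebesgue T f"
    by (rule set_integrable_subset) (use assms in auto)
  then show ?thesis
    using assms(3) unfolding set_integrable_def by (subst integrable_restrict_space) auto
qed

text \<open>A bounded \<open>K\<close> lies in a box, on which the polynomial is continuous and
  hence integrable; the result is then restricted to \<open>K\<close>.\<close>

lemma polynomial_on_integrable:
  fixes f :: "'a::euclidean_space \<Rightarrow> real"
  assumes "open K" "bounded K" "polynomial_on K f"
  shows "integrable (lebesgue_on K) f"
proof -
  obtain P where P: "real_polynomial_function P" "\<forall>x\<in>K. f x = P x"
    using assms(3) unfolding polynomial_on_def by blast
  obtain a b where ab: "K \<subseteq> cbox a b"
    using assms(2) bounded_subset_cbox_symmetric by blast
  have "continuous_on (cbox a b) P"
    using P(1) continuous_on_polymonial_function real_polynomial_function_eq by blast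
  then have "integrable (lebesgue_on (cbox a b)) P"
    by (rule continuous_imp_integrable)
  then have "integrable (lebesgue_on K) P"
    using assms(1) ab by (intro integrable_lebesgue_on_subset[of "cbox a b" P K]) auto
  with P(2) show ?thesis
    by (subst Bochner_Integration.integrable_cong[of _ "lebesgue_on K" _ P]) auto
qed

section \<open>Integration over a mesh\<close>

text \<open>Integrability is assumed on the elements only, so that \<open>f\<close> may be anything
  on the skeleton, where \<open>grad p\<close> has no controlled value. The gauge integral adds up
  over the disjoint elements and ignores the null skeleton; nonnegativity of \<open>f\<close> turns
  gauge integrability on \<open>\<Omega>\<close> into Lebesgue integrability.\<close>

lemma mesh_of_integral:
  fixes f :: "real^2 \<Rightarrow> real"
  assumes mesh: "mesh_of \<Omega> \<T>" and \<Omega>: "open \<Omega>"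
    and f: "\<And>K. K \<in> \<T> \<Longrightarrow> integrable (lebesgue_on K) f" and nonneg: "\<And>x. f x \<ge> 0"
  shows "(LINT x|lebesgue_on \<Omega>. f x) = (\<Sum>K\<in>\<T>. LINT x|lebesgue_on K. f x)"
proof -
  have opn: "open K" if "K \<in> \<T>" for K
    using mesh that unfolding mesh_of_def by blast
  have "(f has_integral (LINT x|lebesgue_on K. f x)) K" if "K \<in> \<T>" for K
    using has_integral_integral_lebesgue_on[OF f[OF that]] opn[OF that] by auto
  then have "(f has_integral (\<Sum>K\<in>\<T>. LINT x|lebesgue_on K. f x)) (\<Union>\<T>)"
    using mesh unfolding mesh_of_def
    by (intro has_integral_Union) (auto simp: pairwise_def disjnt_def)
  \<comment> \<open>\<open>\<Union>\<T>\<close> and \<open>\<Omega>\<close> differ by a null set: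
    one difference is empty because the elements lie in \<open>\<Omega>\<close>, the other is the
    skeleton.\<close>
  moreover have "{x \<in> \<Union>\<T> - \<Omega>. f x \<noteq> 0} = {}" "negligible (\<Omega> - \<Union>\<T>)"
    using mesh unfolding mesh_of_def by blast+
  then have "negligible {x \<in> \<Union>\<T> - \<Omega>. f x \<noteq> 0}" "negligible {x \<in> \<Omega> - \<Union>\<T>. f x \<noteq> 0}"
    by (simp only: negligible_empty, elim negligible_subset) auto
  ultimately have int: "(f has_integral (\<Sum>K\<in>\<T>. LINT x|lebesgue_on K. f x)) \<Omega>"
    using has_integral_spike_set_eq[of "\<Union>\<T>" \<Omega> f] by blast
  then have "f absolutely_integrable_on \<Omega>"
    using nonneg by (intro nonnegative_absolutely_integrable_1) (auto simp: integrable_on_def)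
  then have "integrable (lebesgue_on \<Omega>) f"
    using \<Omega> unfolding set_integrable_def by (subst integrable_restrict_space) auto
  then have "(LINT x|lebesgue_on \<Omega>. f x) = integral \<Omega> f"
    using \<Omega> by (intro lebesgue_integral_eq_integral) auto
  with int show ?thesis
    by (simp add: integral_unique)
qed

section \<open>Norms and square integrability of weak gradients\<close>

lemma L2_inner_self_nonneg: "L2_inner S f f \<ge> 0"
  unfolding L2_inner_def by (intro integral_nonneg_AE) simp

lemma L2_norm_squared: "(L2_norm S f)\<^sup>2 = L2_inner S f f"
  unfolding L2_norm_def using L2_inner_self_nonneg by simp

lemma weak_grad_L2: "v \<in> H1 \<Omega> \<Longrightarrow> weak_grad \<Omega> v \<in> L2 \<Omega>"
  unfolding H1_def weak_grad_def by (rule someI2_ex[of _ "\<lambda>g. g \<in> L2 \<Omega>"]) auto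

lemma weak_grad_vec_integrable:
  assumes "u \<in> velocity_space \<Omega>"
  shows "integrable (lebesgue_on \<Omega>) (\<lambda>x. weak_grad_vec \<Omega> u x \<bullet> weak_grad_vec \<Omega> u x)"
proof -
  have "integrable (lebesgue_on \<Omega>) (\<lambda>x. (norm (weak_grad \<Omega> (\<lambda>y. u y $ i) x))\<^sup>2)" for i
    using assms weak_grad_L2 unfolding velocity_space_def L2_def by blast
  then show ?thesis
    unfolding inner_vec_def[where ?'b = 2] weak_grad_vec_def power2_norm_eq_inner
    by simp
qed

section \<open>Stabilization matrices\<close>

lemma diag3_mult: "diag3 a b c ** diag3 a' b' c' = diag3 (a * a') (b * b') (c * c')"
  by (simp add: vec_eq_iff forall_3 matrix_matrix_mult_def sum_3 diag3_def)

lemma diag3_vector_join: "diag3 a a c *v join v q = join (a *\<^sub>R v) (c * q)"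
  by (simp add: vec_eq_iff forall_3 matrix_vector_mult_def sum_3 diag3_def join_def)

lemma diag3_one: "diag3 1 1 1 = mat 1"
  by (simp add: vec_eq_iff forall_3 diag3_def mat_def)

text \<open>\<open>matrix_inv\<close> is a choice of a two-sided inverse. For square matrices over a
  field a right inverse is also a left inverse, and two-sided inverses are unique.\<close>

lemma matrix_inv_eqI:
  fixes A B :: "'a::field^'n^'n"
  assumes "A ** B = mat 1"
  shows "matrix_inv A = B"
proof -
  have "B ** A = mat 1"
    using assms matrix_left_right_inverse by blast
  then have "A ** matrix_inv A = mat 1 \<and> matrix_inv A ** A = mat 1"
    unfolding matrix_inv_def
    using someI[of "\<lambda>A'. A ** A' = mat 1 \<and> A' ** A = mat 1" B] assms by blast
  then show ?thesis
    by (metis \<open>B ** A = mat 1\<close> matrix_mul_assoc matrix_mul_lid matrix_mul_rid)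
qed

lemma matrix_inv_diag3:
  "a \<noteq> 0 \<Longrightarrow> b \<noteq> 0 \<Longrightarrow> c \<noteq> 0 \<Longrightarrow> matrix_inv (diag3 a b c) = diag3 (1/a) (1/b) (1/c)"
  by (rule matrix_inv_eqI) (simp add: diag3_mult diag3_one)

lemma diag3_add: "diag3 a b c + diag3 a' b' c' = diag3 (a + a') (b + b') (c + c')"
  by (simp add: vec_eq_iff forall_3 diag3_def)

lemma diag3_diff: "diag3 a b c - diag3 a' b' c' = diag3 (a - a') (b - b') (c - c')"
  by (simp add: vec_eq_iff forall_3 diag3_def)

lemma diag3_scaleR: "k *\<^sub>R diag3 a b c = diag3 (k * a) (k * b) (k * c)"
  by (simp add: vec_eq_iff forall_3 diag3_def)

lemma join_add: "join a b + join c d = join (a + c) (b + d)"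
  by (simp add: vec_eq_iff forall_3 join_def)

lemma join_scaleR: "k *\<^sub>R join a b = join (k *\<^sub>R a) (k * b)"
  by (simp add: vec_eq_iff forall_3 join_def)

lemma join_uminus: "- join a b = join (- a) (- b)"
  by (simp add: vec_eq_iff forall_3 join_def)

lemma join_inner: "join a b \<bullet> join c d = a \<bullet> c + b * d"
  by (simp add: inner_vec_def sum_3 sum_2 join_def)

text \<open>The mass matrix vanishes in the pressure slot, so the third entry of \<tau> is unchanged
  in \<tau>'. Hence the third entry of \<open>mat 1 - ...\<close> is 0, and the subtracted residual
  term tests against the velocity alone.\<close>

lemma stab_matrix_dt_eq:
  assumes "\<mu> > 0" "c\<^sub>1 > 0" "c\<^sub>2 > 0" "h > 0" "dt > 0" and t: "t = stab_1 \<mu> c\<^sub>1 h"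
  shows "stab_matrix_dt \<mu> c\<^sub>1 c\<^sub>2 dt h =
      diag3 (t * dt / (dt + t)) (t * dt / (dt + t)) (stab_2 \<mu> c\<^sub>1 c\<^sub>2 h)" (is ?dt)
    and "mat 1 - matrix_inv (stab_matrix \<mu> c\<^sub>1 c\<^sub>2 h) ** stab_matrix_dt \<mu> c\<^sub>1 c\<^sub>2 dt h =
      diag3 (t / (dt + t)) (t / (dt + t)) 0" (is ?sub)
proof -
  have "t > 0"
    using assms unfolding stab_1_def by simp
  moreover have "stab_2 \<mu> c\<^sub>1 c\<^sub>2 h > 0"
    using assms \<open>t > 0\<close> unfolding stab_2_def by simp
  ultimately have pos: "t > 0" "stab_2 \<mu> c\<^sub>1 c\<^sub>2 h > 0" "1 / dt + 1 / t > 0"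
    using \<open>dt > 0\<close> by (auto intro: add_pos_pos)
  have inv: "1 / (1 / dt + 1 / t) = t * dt / (dt + t)"
    using pos \<open>dt > 0\<close> by (simp add: field_simps)
  have \<tau>: "matrix_inv (stab_matrix \<mu> c\<^sub>1 c\<^sub>2 h) = diag3 (1 / t) (1 / t) (1 / stab_2 \<mu> c\<^sub>1 c\<^sub>2 h)"
    using pos unfolding stab_matrix_def t[symmetric] by (simp add: matrix_inv_diag3)
  show ?dt
    using pos unfolding stab_matrix_dt_def \<tau> mass_matrix_def inv[symmetric]
    by (simp add: diag3_scaleR diag3_add matrix_inv_diag3)
  then show ?sub
    using pos \<open>dt > 0\<close> unfolding \<tau> diag3_one[symmetric]
    by (simp add: diag3_mult diag3_diff field_simps)
qed

section \<open>Coercivity\<close>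

text \<open>To be read with \<open>A\<close>, \<open>B\<close>, \<open>G\<close> the squared norms
  of u, \<Delta>u, \<nabla>p and \<open>P\<close>, \<open>Q\<close> the products of u with \<Delta>u
  and with \<nabla>p. Both mixed products occur with weight \<open>t / (dt + t)\<close> in two
  places: the \<open>Q\<close> terms cancel, the \<open>P\<close> terms double. What exceeds the
  lower bound is a complete square, which is Young's inequality with its remainder made
  explicit.\<close>

lemma stabilized_integrand_identity:
  fixes dt t r A B P Q G \<mu> :: real
  assumes "dt > 0" "t > 0" "r > 0"
  shows "1 / dt * A - t / (dt + t) * (1 / dt * A - \<mu> * P + Q)
        + t * dt / (dt + t) * (1 / dt * (\<mu> * P + Q) - \<mu>\<^sup>2 * B + G)
        - ((1 - r) / (dt + t) * A - t * \<mu>\<^sup>2 * (dt + t / r) / (dt + t) * B + t * dt / (dt + t) * G)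
      = 1 / (r * (dt + t)) * (r\<^sup>2 * A + 2 * r * t * \<mu> * P + t\<^sup>2 * \<mu>\<^sup>2 * B)" (is "?l = ?r")
proof -
  have s: "dt + t \<noteq> 0" "dt \<noteq> 0" "r \<noteq> 0" using assms by auto
  have 1: "1 / dt - t / (dt + t) * (1 / dt) = 1 / (dt + t)"
    using s by (simp add: divide_simps)
  have 2: "t * dt / (dt + t) * (1 / dt) = t / (dt + t)"
    using s by simp
  have 3: "t * (dt + t / r) / (dt + t) - t * dt / (dt + t) = t\<^sup>2 / (r * (dt + t))"
    by (simp add: distrib_left power2_eq_square flip: diff_divide_distrib)
  have 4: "t * \<mu>\<^sup>2 * (dt + t / r) / (dt + t) * B = t * (dt + t / r) / (dt + t) * (\<mu>\<^sup>2 * B)"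
    by simp
  \<comment> \<open>Terms are regrouped with opaque coefficients, so that the fractions are not
    multiplied out; facts 1 to 3 then evaluate each group.\<close>
  have "\<alpha> * A - \<beta> * (\<alpha> * A - \<mu> * P + Q) + \<gamma> * (\<alpha> * (\<mu> * P + Q) - \<mu>\<^sup>2 * B + G)
        - (\<epsilon> * A - \<delta> * (\<mu>\<^sup>2 * B) + \<gamma> * G)
      = (\<alpha> - \<beta> * \<alpha>) * A + (\<beta> + \<gamma> * \<alpha>) * (\<mu> * P) + (\<gamma> * \<alpha> - \<beta>) * Q
        + (\<delta> - \<gamma>) * (\<mu>\<^sup>2 * B) - \<epsilon> * A" for \<alpha> \<beta> \<gamma> \<delta> \<epsilon>
    by (simp add: algebra_simps)
  then have "?l = (1 / dt - t / (dt + t) * (1 / dt)) * A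
        + (t / (dt + t) + t * dt / (dt + t) * (1 / dt)) * (\<mu> * P)
        + (t * dt / (dt + t) * (1 / dt) - t / (dt + t)) * Q
        + (t * (dt + t / r) / (dt + t) - t * dt / (dt + t)) * (\<mu>\<^sup>2 * B) - (1 - r) / (dt + t) * A"
    unfolding 4 .
  also have "\<dots> = r / (dt + t) * A + 2 * (t / (dt + t)) * (\<mu> * P) + t\<^sup>2 / (r * (dt + t)) * (\<mu>\<^sup>2 * B)"
    unfolding 1 2 3 by (simp add: diff_divide_distrib left_diff_distrib)
  also have "\<dots> = ?r"
  proof -
    have *: "r / (dt + t) = 1 / (r * (dt + t)) * r\<^sup>2" "t / (dt + t) = 1 / (r * (dt + t)) * (r * t)"
      "t\<^sup>2 / (r * (dt + t)) = 1 / (r * (dt + t)) * t\<^sup>2"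
      using s by (simp_all add: power2_eq_square)
    have "k * r\<^sup>2 * A + 2 * (k * (r * t)) * (\<mu> * P) + k * t\<^sup>2 * (\<mu>\<^sup>2 * B)
        = k * (r\<^sup>2 * A + 2 * r * t * \<mu> * P + t\<^sup>2 * \<mu>\<^sup>2 * B)" for k
      by (simp add: algebra_simps)
    then show ?thesis
      unfolding * .
  qed
  finally show ?thesis .
qed

text \<open>Two nonnegative terms are discarded: the square norm of
  \<open>r *\<^sub>R a + (t * \<mu>) *\<^sub>R b\<close>, suitably scaled, and the divergence term
  \<open>t2 * d\<^sup>2\<close>.\<close>

lemma stabilized_integrand_ge:
  fixes a b g :: "'a::real_inner"
  assumes "dt > 0" "t > 0" "r > 0" "t2 \<ge> 0"
  shows "(1 - r) / (dt + t) * (a \<bullet> a) - t * \<mu>\<^sup>2 * (dt + t / r) / (dt + t) * (b \<bullet> b)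
           + t * dt / (dt + t) * (g \<bullet> g)
    \<le> 1 / dt * (a \<bullet> a) - ((t / (dt + t)) *\<^sub>R ((1 / dt) *\<^sub>R a + (- \<mu> *\<^sub>R b + g))) \<bullet> a
      + (((t * dt / (dt + t)) *\<^sub>R ((1 / dt) *\<^sub>R a + (- \<mu> *\<^sub>R b + g))) \<bullet> (\<mu> *\<^sub>R b + g) + t2 * d\<^sup>2)"
    (is "?L \<le> ?R")
proof -
  have a: "((1 / dt) *\<^sub>R a + (- \<mu> *\<^sub>R b + g)) \<bullet> a
      = 1 / dt * (a \<bullet> a) - \<mu> * (a \<bullet> b) + a \<bullet> g"
    by (simp add: inner_simps inner_commute)
  have g: "((1 / dt) *\<^sub>R a + (- \<mu> *\<^sub>R b + g)) \<bullet> (\<mu> *\<^sub>R b + g)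
      = 1 / dt * (\<mu> * (a \<bullet> b) + a \<bullet> g) - \<mu>\<^sup>2 * (b \<bullet> b) + g \<bullet> g"
    by (simp add: inner_simps inner_commute power2_eq_square algebra_simps)
  have "r\<^sup>2 * (a \<bullet> a) + 2 * r * t * \<mu> * (a \<bullet> b) + t\<^sup>2 * \<mu>\<^sup>2 * (b \<bullet> b)
      = (r *\<^sub>R a + (t * \<mu>) *\<^sub>R b) \<bullet> (r *\<^sub>R a + (t * \<mu>) *\<^sub>R b)"
    by (simp add: inner_simps inner_commute power2_eq_square algebra_simps)
  then have square: "0 \<le> 1 / (r * (dt + t))
      * (r\<^sup>2 * (a \<bullet> a) + 2 * r * t * \<mu> * (a \<bullet> b) + t\<^sup>2 * \<mu>\<^sup>2 * (b \<bullet> b))"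
    using assms by (simp only:) simp
  have div: "0 \<le> t2 * d\<^sup>2"
    using assms(4) by simp
  have le: "L \<le> E - F + (G + Y)" if "0 \<le> X" "0 \<le> Y" "E - F + G - L = X"
    for E F G L X Y :: real
    using that by linarith
  show ?thesis
    unfolding inner_scaleR_left a g
    by (rule le[OF square div stabilized_integrand_identity[OF assms(1-3)]])
qed

text \<open>The pointwise bound is integrated over each element, the inverse inequality trades the
  classical Laplacian for the weak gradient, and the sum over the mesh is absorbed by the viscous
  term. The coefficients are explicit; their signs are settled in \<open>theorem1\<close>.\<close>

lemma B_ASGS_coercive:
  assumes mesh: "mesh_of \<Omega> \<T>" and \<Omega>: "open \<Omega>" "bounded \<Omega>"
    and h: "mesh_size \<T> = h" "h > 0"
    and inverse: "inverse_inequality \<Omega> \<T> l C\<^sub>I" "C\<^sub>I > 0"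
    and u: "u \<in> velocity_fe_space \<Omega> \<T> l" and p: "p \<in> pressure_fe_space \<Omega> \<T> l"
    and params: "\<mu> > 0" "c\<^sub>1 > 0" "c\<^sub>2 > 0" "dt > 0"
    and t: "t = stab_1 \<mu> c\<^sub>1 h" and r: "r = C\<^sub>I\<^sup>2 / c\<^sub>1"
  shows "B_ASGS \<Omega> \<T> \<mu> c\<^sub>1 c\<^sub>2 dt (u, p) (u, p) \<ge>
    (1 - r) / (dt + t) * (L2_norm \<Omega> u)\<^sup>2
    + \<mu> * (1 - r) * dt / (dt + t) * (L2_norm \<Omega> (weak_grad_vec \<Omega> u))\<^sup>2
    + t * dt / (dt + t) * (L2_norm \<Omega> (grad p))\<^sup>2"
proof -
  let ?G = "weak_grad_vec \<Omega> u"
  let ?\<Delta> = "laplacian_vec u"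
  define t2 where "t2 = stab_2 \<mu> c\<^sub>1 c\<^sub>2 h"
  define R where "R x = (1 / dt) *\<^sub>R u x + (- \<mu> *\<^sub>R ?\<Delta> x + grad p x)" for x
  \<comment> \<open>\<open>E\<close> gathers everything except the viscous term: mass, subtracted
    residual, and residual tested against the adjoint operator. The viscous term stays outside as a
    weak-gradient integral over \<open>\<Omega>\<close>.\<close>
  define E where "E x = 1 / dt * (u x \<bullet> u x) - ((t / (dt + t)) *\<^sub>R R x) \<bullet> u x
      + (((t * dt / (dt + t)) *\<^sub>R R x) \<bullet> (\<mu> *\<^sub>R ?\<Delta> x + grad p x) + t2 * (divergence u x)\<^sup>2)" for x
  have pos: "t > 0" "t2 > 0" "r > 0" "dt + t > 0"
    using params h inverse(2) unfolding t t2_def r stab_1_def stab_2_def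
    by (auto intro!: divide_pos_pos mult_pos_pos add_pos_pos)

  have elem: "open K" "bounded K" if "K \<in> \<T>" for K
    using mesh that \<Omega>(2) bounded_subset unfolding mesh_of_def by blast+
  have pu: "polynomial_on K (\<lambda>x. u x $ i)" and pp: "polynomial_on K p" if "K \<in> \<T>" for K i
    using u p that poly_on_imp_polynomial_on
    unfolding velocity_fe_space_def pressure_fe_space_def by blast+
  note poly = pu pp polynomial_on_grad[OF elem(1) pp] polynomial_on_laplacian_vec[OF elem(1) pu]
    polynomial_on_divergence[OF elem(1) pu]
  have pR: "polynomial_on K (\<lambda>x. R x $ i)" if "K \<in> \<T>" for K i
    unfolding R_def vector_add_component vector_scaleR_component real_scaleR_def
    by (intro polynomial_on_intros poly that)
  note int = polynomial_on_integrable[OF elem]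

  have int_u: "integrable (lebesgue_on K) (\<lambda>x. u x \<bullet> u x)"
    and int_\<Delta>: "integrable (lebesgue_on K) (\<lambda>x. ?\<Delta> x \<bullet> ?\<Delta> x)"
    and int_p: "integrable (lebesgue_on K) (\<lambda>x. grad p x \<bullet> grad p x)"
    and int_Ru: "integrable (lebesgue_on K) (\<lambda>x. ((t / (dt + t)) *\<^sub>R R x) \<bullet> u x)"
    and int_Rp: "integrable (lebesgue_on K) (\<lambda>x. ((t * dt / (dt + t)) *\<^sub>R R x) \<bullet> (\<mu> *\<^sub>R ?\<Delta> x + grad p x)
      + t2 * (divergence u x)\<^sup>2)" if "K \<in> \<T>" for K
    unfolding inner_scaleR_left inner_scaleR_right inner_add_right power2_eq_square
    by (intro int polynomial_on_inner polynomial_on_intros poly pR that)+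
  \<comment> \<open>The weak gradient is a chosen square integrable function, so its integrability
    on the elements is obtained by restriction from \<open>\<Omega>\<close> instead of from a
    polynomial representation.\<close>
  have int_G: "integrable (lebesgue_on \<Omega>) (\<lambda>x. ?G x \<bullet> ?G x)"
    using u weak_grad_vec_integrable unfolding velocity_fe_space_def by blast
  have int_GK: "integrable (lebesgue_on K) (\<lambda>x. ?G x \<bullet> ?G x)" if "K \<in> \<T>" for K
  proof -
    have "K \<subseteq> \<Omega>"
      using mesh that unfolding mesh_of_def by blast
    then show ?thesis
      using elem(1)[OF that] \<Omega>(1) by (intro integrable_lebesgue_on_subset[OF int_G]) auto
  qed

  have inner_\<Omega>: "L2_inner \<Omega> f f = (\<Sum>K\<in>\<T>. L2_inner K f f)"
    if "\<And>K. K \<in> \<T> \<Longrightarrow> integrable (lebesgue_on K) (\<lambda>x. f x \<bullet> f x)"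
    for f :: "real^2 \<Rightarrow> 'b::euclidean_space"
    unfolding L2_inner_def using mesh_of_integral[OF mesh \<Omega>(1) that] by simp

  have B: "B_ASGS \<Omega> \<T> \<mu> c\<^sub>1 c\<^sub>2 dt (u, p) (u, p)
      = \<mu> * L2_inner \<Omega> ?G ?G + (\<Sum>K\<in>\<T>. LINT x|lebesgue_on K. E x)"
  proof -
    have mass: "(1 / dt) *\<^sub>R (mass_matrix *v field (u, p) x) = join ((1 / dt) *\<^sub>R u x) 0" for x
      unfolding mass_matrix_def field_def by (simp add: diag3_vector_join join_scaleR)
    have res: "join ((1 / dt) *\<^sub>R u x) 0 + stokes_op \<mu> (u, p) x = join (R x) (divergence u x)" for x
      unfolding stokes_op_def R_def by (simp add: join_add)
    have adj: "- stokes_op_adj \<mu> (u, p) x = join (\<mu> *\<^sub>R ?\<Delta> x + grad p x) (divergence u x)" for x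
      unfolding stokes_op_adj_def by (simp add: join_uminus add.commute)
    \<comment> \<open>The mass term is the one other global integral that survives; it is split over
      the elements in order to enter \<open>E\<close>.\<close>
    have "L2_inner \<Omega> (\<lambda>x. join ((1 / dt) *\<^sub>R u x) 0) (field (u, p)) = 1 / dt * L2_inner \<Omega> u u"
      unfolding L2_inner_def field_def by (simp add: join_inner)
    also have "\<dots> = (\<Sum>K\<in>\<T>. 1 / dt * L2_inner K u u)"
      by (simp add: inner_\<Omega>[OF int_u] sum_distrib_left)
    finally have mass_inner: "L2_inner \<Omega> (\<lambda>x. join ((1 / dt) *\<^sub>R u x) 0) (field (u, p))
        = (\<Sum>K\<in>\<T>. 1 / dt * L2_inner K u u)" .
    have "B_ASGS \<Omega> \<T> \<mu> c\<^sub>1 c\<^sub>2 dt (u, p) (u, p) = \<mu> * L2_inner \<Omega> ?G ?G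
        - (\<Sum>K\<in>\<T>. LINT x|lebesgue_on K. ((t / (dt + t)) *\<^sub>R R x) \<bullet> u x)
        + (\<Sum>K\<in>\<T>. 1 / dt * L2_inner K u u)
        + (\<Sum>K\<in>\<T>. LINT x|lebesgue_on K. ((t * dt / (dt + t)) *\<^sub>R R x) \<bullet> (\<mu> *\<^sub>R ?\<Delta> x + grad p x)
            + t2 * (divergence u x)\<^sup>2)"
      \<comment> \<open>The order matters: \<open>mat 1 - ...\<close> contains
        \<open>stab_matrix_dt\<close> and must be replaced as a whole before the first equation
        rewrites the remaining occurrence. The divergence-pressure integrals cancel in the final
        \<open>simp\<close>.\<close>
      unfolding B_ASGS_def Let_def mass res adj h(1)
        stab_matrix_dt_eq(2)[OF params(1-3) h(2) params(4) t]
      unfolding stab_matrix_dt_eq(1)[OF params(1-3) h(2) params(4) t]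
        diag3_vector_join t2_def[symmetric] mass_inner
      by (simp add: stokes_form_def L2_inner_def field_def join_inner power2_eq_square mult.assoc)
    also have "\<dots> = \<mu> * L2_inner \<Omega> ?G ?G + (\<Sum>K\<in>\<T>. 1 / dt * L2_inner K u u
        - (LINT x|lebesgue_on K. ((t / (dt + t)) *\<^sub>R R x) \<bullet> u x)
        + (LINT x|lebesgue_on K. ((t * dt / (dt + t)) *\<^sub>R R x) \<bullet> (\<mu> *\<^sub>R ?\<Delta> x + grad p x)
            + t2 * (divergence u x)\<^sup>2))"
      by (simp only: sum.distrib sum_subtractf)
    also have "\<dots> = \<mu> * L2_inner \<Omega> ?G ?G + (\<Sum>K\<in>\<T>. LINT x|lebesgue_on K. E x)"
    proof -
      have "(LINT x|lebesgue_on K. E x) = 1 / dt * L2_inner K u u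
          - (LINT x|lebesgue_on K. ((t / (dt + t)) *\<^sub>R R x) \<bullet> u x)
          + (LINT x|lebesgue_on K. ((t * dt / (dt + t)) *\<^sub>R R x) \<bullet> (\<mu> *\<^sub>R ?\<Delta> x + grad p x)
              + t2 * (divergence u x)\<^sup>2)" if "K \<in> \<T>" for K
        unfolding E_def L2_inner_def integral_mult_right_zero[symmetric]
        using int_u[OF that] int_Ru[OF that] int_Rp[OF that]
        by (simp only: Bochner_Integration.integral_add Bochner_Integration.integral_diff
            Bochner_Integration.integrable_diff integrable_mult_right)
      then show ?thesis by simp
    qed
    finally show ?thesis .
  qed

  \<comment> \<open>The \<open>dt\<close> part comes from the stabilization term in \<Delta>u
    itself, the \<open>t / r\<close> part is the cost of Young's inequality.\<close>
  let ?k = "t * \<mu>\<^sup>2 * (dt + t / r) / (dt + t)"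
  have elem_ge: "(1 - r) / (dt + t) * L2_inner K u u - \<mu> * r * (dt + t / r) / (dt + t) * L2_inner K ?G ?G
      + t * dt / (dt + t) * L2_inner K (grad p) (grad p) \<le> (LINT x|lebesgue_on K. E x)"
    if K: "K \<in> \<T>" for K
  proof -
    have "L2_norm K ?\<Delta> \<le> C\<^sub>I / h * L2_norm K ?G"
      using inverse(1) u K h(1) unfolding inverse_inequality_def by blast
    moreover have "0 \<le> L2_norm K ?\<Delta>"
      unfolding L2_norm_def by (simp add: L2_inner_self_nonneg)
    ultimately have "(L2_norm K ?\<Delta>)\<^sup>2 \<le> (C\<^sub>I / h * L2_norm K ?G)\<^sup>2"
      by (rule power_mono)
    then have "L2_inner K ?\<Delta> ?\<Delta> \<le> (C\<^sub>I / h)\<^sup>2 * L2_inner K ?G ?G"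
      unfolding power_mult_distrib[of "C\<^sub>I / h"] L2_norm_squared .
    then have "?k * L2_inner K ?\<Delta> ?\<Delta> \<le> ?k * ((C\<^sub>I / h)\<^sup>2 * L2_inner K ?G ?G)"
      using pos params by (intro mult_left_mono) auto
    \<comment> \<open>Since \<open>t = h\<^sup>2 / (c\<^sub>1 * \<mu>)\<close>, both
      \<open>h\<close> and \<open>\<mu>\<close> cancel, which is why \<open>r\<close> is independent
      of the mesh.\<close>
    also have "t * \<mu> * (C\<^sub>I / h)\<^sup>2 = r"
      using params h(2) unfolding t r stab_1_def by (simp add: field_simps power2_eq_square)
    then have "?k * ((C\<^sub>I / h)\<^sup>2 * L2_inner K ?G ?G)
        = \<mu> * r * (dt + t / r) / (dt + t) * L2_inner K ?G ?G"
      by (simp add: power2_eq_square mult_ac flip: \<open>t * \<mu> * (C\<^sub>I / h)\<^sup>2 = r\<close>)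
    finally have "?k * L2_inner K ?\<Delta> ?\<Delta> \<le> \<mu> * r * (dt + t / r) / (dt + t) * L2_inner K ?G ?G" .
    moreover have "(1 - r) / (dt + t) * L2_inner K u u - ?k * L2_inner K ?\<Delta> ?\<Delta>
        + t * dt / (dt + t) * L2_inner K (grad p) (grad p)
      = (LINT x|lebesgue_on K. (1 - r) / (dt + t) * (u x \<bullet> u x) - ?k * (?\<Delta> x \<bullet> ?\<Delta> x)
        + t * dt / (dt + t) * (grad p x \<bullet> grad p x))"
      unfolding L2_inner_def using int_u[OF K] int_\<Delta>[OF K] int_p[OF K] by simp
    moreover have "\<dots> \<le> (LINT x|lebesgue_on K. E x)"
    proof (rule integral_mono)
      show "integrable (lebesgue_on K) E"
        unfolding E_def
        by (rule Bochner_Integration.integrable_add[OF Bochner_Integration.integrable_diff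
              [OF integrable_mult_right[OF int_u[OF K]] int_Ru[OF K]] int_Rp[OF K]])
    next
      fix x
      show "(1 - r) / (dt + t) * (u x \<bullet> u x) - ?k * (?\<Delta> x \<bullet> ?\<Delta> x)
        + t * dt / (dt + t) * (grad p x \<bullet> grad p x) \<le> E x"
        unfolding E_def R_def using pos params
        by (intro stabilized_integrand_ge) auto
    qed (use int_u[OF K] int_\<Delta>[OF K] int_p[OF K] in simp)
    ultimately show ?thesis
      by linarith
  qed
  \<comment> \<open>The Young weight is chosen for this:
    \<open>r * (dt + t / r) = r * dt + t\<close>, so the two \<open>t\<close> in the numerator
    cancel and the factor \<open>1 - r\<close> appears, as it does for u.\<close>
  have coeff: "\<mu> - \<mu> * r * (dt + t / r) / (dt + t) = \<mu> * (1 - r) * dt / (dt + t)"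
    using pos by (simp add: divide_simps) (simp add: algebra_simps)
  have "(1 - r) / (dt + t) * L2_inner \<Omega> u u
      - \<mu> * r * (dt + t / r) / (dt + t) * L2_inner \<Omega> ?G ?G
      + t * dt / (dt + t) * L2_inner \<Omega> (grad p) (grad p)
    \<le> (\<Sum>K\<in>\<T>. LINT x|lebesgue_on K. E x)"
    using sum_mono[OF elem_ge]
    by (simp only: inner_\<Omega>[OF int_u] inner_\<Omega>[OF int_GK] inner_\<Omega>[OF int_p]
        sum.distrib sum_subtractf sum_distrib_left)
  then show ?thesis
    unfolding B L2_norm_squared coeff[symmetric] by (simp add: left_diff_distrib)
qed

text \<open>\<open>c1_large\<close> says \<open>r < 1\<close>, which makes the coefficients of
  \<open>B_ASGS_coercive\<close> positive. They depend on \<open>h\<close> and \<open>dt\<close> but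
  not on the individual mesh, so they can be fixed before \<open>\<T>\<close>.\<close>

theorem theorem1:
  fixes \<Omega> :: "(real^2) set" and \<M> :: "(real^2) set set set"
    and \<mu> c\<^sub>1 c\<^sub>2 C\<^sub>I \<sigma> :: real and l :: nat
  assumes domain: "piecewise_smooth_domain \<Omega>"
    and params: "\<mu> > 0" "c\<^sub>1 > 0" "c\<^sub>2 > 0" "l \<ge> 1"
    and partitions: "\<And>\<T>. \<T> \<in> \<M> \<Longrightarrow> mesh_of \<Omega> \<T> \<and> regular_mesh \<sigma> \<T>"
    and inverse: "C\<^sub>I > 0" "\<And>\<T>. \<T> \<in> \<M> \<Longrightarrow> inverse_inequality \<Omega> \<T> l C\<^sub>I"
    and c1_large: "c\<^sub>1 > C\<^sub>I\<^sup>2"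
  shows "\<exists>C>0. \<forall>h>0. \<forall>dt > C * h\<^sup>2.
           \<exists>C\<^sub>1>0. \<exists>C\<^sub>2>0. \<exists>C\<^sub>3>0. \<forall>\<T>\<in>\<M>. mesh_size \<T> = h \<longrightarrow>
             (\<forall>u \<in> velocity_fe_space \<Omega> \<T> l. \<forall>p \<in> pressure_fe_space \<Omega> \<T> l.
                B_ASGS \<Omega> \<T> \<mu> c\<^sub>1 c\<^sub>2 dt (u, p) (u, p) \<ge>
                  C\<^sub>1 * (L2_norm \<Omega> u)\<^sup>2 + C\<^sub>2 * (L2_norm \<Omega> (weak_grad_vec \<Omega> u))\<^sup>2
                  + C\<^sub>3 * (L2_norm \<Omega> (grad p))\<^sup>2)"
proof -
  have \<Omega>: "open \<Omega>" "bounded \<Omega>"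
    using domain unfolding piecewise_smooth_domain_def by auto
  define r where "r = C\<^sub>I\<^sup>2 / c\<^sub>1"
  have r: "r < 1"
    using c1_large params(2) unfolding r_def by simp
  show ?thesis
  \<comment> \<open>With the witness 1 the time step satisfies \<open>dt > h\<^sup>2\<close>, which
    supplies \<open>dt > 0\<close>.\<close>
  proof (rule exI[of _ 1], intro conjI allI impI)
    fix h dt :: real
    assume h: "h > 0" and "dt > 1 * h\<^sup>2"
    then have dt: "dt > 0"
      by (smt (verit) zero_le_power2)
    define t where "t = stab_1 \<mu> c\<^sub>1 h"
    have t: "t > 0"
      using h params unfolding t_def stab_1_def by simp
    show "\<exists>C\<^sub>1>0. \<exists>C\<^sub>2>0. \<exists>C\<^sub>3>0. \<forall>\<T>\<in>\<M>. mesh_size \<T> = h \<longrightarrow>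
             (\<forall>u \<in> velocity_fe_space \<Omega> \<T> l. \<forall>p \<in> pressure_fe_space \<Omega> \<T> l.
                B_ASGS \<Omega> \<T> \<mu> c\<^sub>1 c\<^sub>2 dt (u, p) (u, p) \<ge>
                  C\<^sub>1 * (L2_norm \<Omega> u)\<^sup>2 + C\<^sub>2 * (L2_norm \<Omega> (weak_grad_vec \<Omega> u))\<^sup>2
                  + C\<^sub>3 * (L2_norm \<Omega> (grad p))\<^sup>2)"
    proof (intro exI conjI ballI impI)
      show "(1 - r) / (dt + t) > 0" "\<mu> * (1 - r) * dt / (dt + t) > 0" "t * dt / (dt + t) > 0"
        using r t dt params(1) by auto
    next
      fix \<T> u p
      assume "\<T> \<in> \<M>" "mesh_size \<T> = h" "u \<in> velocity_fe_space \<Omega> \<T> l" "p \<in> pressure_fe_space \<Omega> \<T> l"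
      then show "B_ASGS \<Omega> \<T> \<mu> c\<^sub>1 c\<^sub>2 dt (u, p) (u, p) \<ge>
          (1 - r) / (dt + t) * (L2_norm \<Omega> u)\<^sup>2
          + \<mu> * (1 - r) * dt / (dt + t) * (L2_norm \<Omega> (weak_grad_vec \<Omega> u))\<^sup>2
          + t * dt / (dt + t) * (L2_norm \<Omega> (grad p))\<^sup>2"
        using B_ASGS_coercive[OF _ \<Omega> _ h _ inverse(1) _ _ params(1-3) dt t_def r_def]
          partitions inverse(2) by blast
    qed
  qed simp
qed

end
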